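(* Every $n$-qubit unitary stabilizer circuit has an equivalent circuit in canonical form, i.e. one consisting of $11$ consecutive rounds in the sequence H-C-P-C-P-C-H-P-C-P-C, where a round of type H contains only Hadamard gates, a round of type C contains only CNOT gates, and a round of type P contains only phase gates (rounds may be empty).
   Context: A unitary stabilizer circuit is a circuit consisting only of CNOT gates, Hadamard gates $H=\frac{1}{\sqrt2}\begin{pmatrix}1&1\\1&-1\end{pmatrix}$ and phase gates $\mathrm{diag}(1,i)$. Two unitary stabilizer circuits are equivalent if the unitaries they implement are equal up to a global phase (equivalently, they map each stabilizer state to the same physical state). *)

theory Defs
  imports Complex_Main "Jordan_Normal_Form.Matrix"
begin

text \<open>Gates of an n-qubit unitary stabilizer circuit.  Qubits are numbered 0..n-1;
  computational basis states are indexed by k < 2^n, qubit i being bit i of k.\<close>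

datatype gate = Had nat | Phase nat | CNOT nat nat  (* CNOT control target *)

definition qbit :: "nat \<Rightarrow> nat \<Rightarrow> bool" where
  "qbit k i = odd (k div 2 ^ i)"

definition flip_bit :: "nat \<Rightarrow> nat \<Rightarrow> nat" where
  "flip_bit k i = (if qbit k i then k - 2 ^ i else k + 2 ^ i)"

definition gate_wf :: "nat \<Rightarrow> gate \<Rightarrow> bool" where
  "gate_wf n g = (case g of
      Had i \<Rightarrow> i < n
    | Phase i \<Rightarrow> i < n
    | CNOT a b \<Rightarrow> a < n \<and> b < n \<and> a \<noteq> b)"

definition circuit_wf :: "nat \<Rightarrow> gate list \<Rightarrow> bool" where
  "circuit_wf n gs = (\<forall>g \<in> set gs. gate_wf n g)"

definition gate_mat :: "nat \<Rightarrow> gate \<Rightarrow> complex mat" where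
  "gate_mat n g = (case g of
      Had i \<Rightarrow> mat (2 ^ n) (2 ^ n) (\<lambda>(r, c).
          if r = c \<or> r = flip_bit c i
          then (if qbit r i \<and> qbit c i then - 1 else 1) / complex_of_real (sqrt 2)
          else 0)
    | Phase i \<Rightarrow> mat (2 ^ n) (2 ^ n) (\<lambda>(r, c).
          if r = c then (if qbit c i then \<i> else 1) else 0)
    | CNOT a b \<Rightarrow> mat (2 ^ n) (2 ^ n) (\<lambda>(r, c).
          if r = (if qbit c a then flip_bit c b else c) then 1 else 0))"

definition circuit_mat :: "nat \<Rightarrow> gate list \<Rightarrow> complex mat" where
  "circuit_mat n gs = foldl (\<lambda>U g. gate_mat n g * U) (1\<^sub>m (2 ^ n)) gs"

definition circuit_equiv :: "nat \<Rightarrow> gate list \<Rightarrow> gate list \<Rightarrow> bool" where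
  "circuit_equiv n gs hs = (\<exists>c. cmod c = 1 \<and> circuit_mat n gs = c \<cdot>\<^sub>m circuit_mat n hs)"

datatype round_type = RH | RC | RP

fun gate_of_type :: "round_type \<Rightarrow> gate \<Rightarrow> bool" where
  "gate_of_type RH (Had _) = True"
| "gate_of_type RP (Phase _) = True"
| "gate_of_type RC (CNOT _ _) = True"
| "gate_of_type _ _ = False"

definition canonical_pattern :: "round_type list" where
  "canonical_pattern = [RH, RC, RP, RC, RP, RC, RH, RP, RC, RP, RC]"

definition canonical_form :: "gate list \<Rightarrow> bool" where
  "canonical_form gs = (\<exists>rs. length rs = length canonical_pattern \<and> gs = concat rs \<and>
      (\<forall>k < length rs. \<forall>g \<in> set (rs ! k). gate_of_type (canonical_pattern ! k) g))"

end

(* Let B = U H_S, where H_S is a layer of Hadamard gates before the stabilizer unitary U. For a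
   suitable S every entry of B has modulus 2^(-n/2), and B(r,c) is, up to a constant, a quadratic
   form q(r,c) over F_2 in the exponent of i. This is shown by induction on the circuit: phase and
   CNOT gates preserve the shape of B. A Hadamard gate on qubit i is a Gauss sum over the bit r_i,
   and preserves it if q(e_i) = i or -i. Otherwise the sum vanishes at
   half of the entries; as B is invertible, r_i is coupled to some column bit c_j, and adding qubit j
   to S turns the sum into a nonvanishing Gauss sum over r_i and c_j.

   Finally q(r,c) = u(r) (-1)^<Lr,c> v(c) with u, v quadratic and L invertible, so
   B = diag(u) L^-1 H_all diag(v) = L^-1 diag(u') H_all diag(v). Here L^-1 is a CNOT circuit by
   Gaussian elimination, and a quadratic diagonal is C^-1 P C P' with C unitriangular. *)

theory Submission
  imports Defs
begin

unbundle bit_operations_syntax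

section \<open>Bits of natural numbers and XOR\<close>

lemma qbit_eq_bit: "qbit k i = bit k i"
  by (simp add: qbit_def bit_iff_odd)

text \<open>Adding \<open>2 ^ i\<close> where bit \<open>i\<close> is clear causes no carry, so it
  agrees with XOR. The subtraction case is the same fact read backwards from
  \<open>k XOR 2 ^ i\<close>.\<close>

lemma flip_bit_eq_xor: "flip_bit k i = k XOR 2 ^ i"
proof -
  have *: "m + 2 ^ i = m XOR 2 ^ i" if "\<not> bit m i" for m :: nat
    using that by (intro disjunctive_add_eq_xor bit_eqI) (auto simp: bit_and_iff bit_exp_iff)
  have "k = (k XOR 2 ^ i) + 2 ^ i" if "bit k i"
    using *[of "k XOR 2 ^ i"] that by (simp add: bit_xor_iff bit_exp_iff xor.assoc)
  then show ?thesis
    using *[of k] by (auto simp: Defs.flip_bit_def qbit_eq_bit)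
qed

lemma xor_less_power: "x < 2 ^ n \<Longrightarrow> y < 2 ^ n \<Longrightarrow> x XOR y < 2 ^ n" for x y :: nat
  by (metis take_bit_nat_eq_self_iff take_bit_xor)

lemma xor_double_cancel [simp]: "(x XOR y) XOR y = x" for x y :: nat
  by (simp add: xor.assoc)

lemma bit_power_two_nat [simp]: "bit (2 ^ i :: nat) j \<longleftrightarrow> i = j"
  by (auto simp: bit_exp_iff)

lemma bit_above_nat: "x < 2 ^ n \<Longrightarrow> n \<le> i \<Longrightarrow> \<not> bit x i" for x :: nat
  by (metis bit_take_bit_iff not_le take_bit_nat_eq_self_iff)

lemma take_bit_Suc_xor:
  "take_bit (Suc n) x = take_bit n x XOR (if bit x n then 2 ^ n else 0)" for x :: nat
  by (rule bit_eqI) (auto simp: bit_simps less_Suc_eq)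

lemma split_top_bit:
  "x < 2 ^ Suc n \<Longrightarrow> x = take_bit n x XOR (if bit x n then 2 ^ n else 0)" for x :: nat
  by (metis take_bit_Suc_xor take_bit_nat_eq_self_iff)

lemma less_power_Suc: "x < 2 ^ Suc n \<Longrightarrow> \<not> bit x n \<Longrightarrow> x < 2 ^ n" for x :: nat
  by (metis split_top_bit take_bit_nat_eq_self_iff xor.right_neutral)

section \<open>Linear algebra over F_2: naturals under XOR as bit vectors\<close>

definition functional :: "(nat \<Rightarrow> bool) \<Rightarrow> bool" where
  "functional f \<longleftrightarrow> (\<forall>x y. f (x XOR y) = (f x \<noteq> f y))"

definition linear_xor :: "(nat \<Rightarrow> nat) \<Rightarrow> bool" where
  "linear_xor L \<longleftrightarrow> (\<forall>x y. L (x XOR y) = L x XOR L y)"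

lemma functional_xor: "functional f \<Longrightarrow> f (x XOR y) = (f x \<noteq> f y)"
  by (simp add: functional_def)

lemma functional_0: "functional f \<Longrightarrow> \<not> f 0"
  using functional_xor[of f 0 0] by simp

lemma linear_xorD: "linear_xor L \<Longrightarrow> L (x XOR y) = L x XOR L y"
  by (simp add: linear_xor_def)

lemma linear_xor_0: "linear_xor L \<Longrightarrow> L 0 = 0"
  using linear_xorD[of L 0 0] by simp

lemma functional_bit: "functional (\<lambda>x. bit x i)"
  by (simp add: functional_def bit_xor_iff)

lemma functional_neq: "functional f \<Longrightarrow> functional g \<Longrightarrow> functional (\<lambda>x. f x \<noteq> g x)"
  by (auto simp: functional_def)

lemma functional_compose: "functional f \<Longrightarrow> linear_xor L \<Longrightarrow> functional (\<lambda>x. f (L x))"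
  by (simp add: functional_def linear_xor_def)

lemma linear_xor_compose: "linear_xor K \<Longrightarrow> linear_xor L \<Longrightarrow> linear_xor (\<lambda>x. K (L x))"
  by (simp add: linear_xor_def)

lemma linear_xor_push_bit: "linear_xor (push_bit n)"
  by (simp add: linear_xor_def)

text \<open>The powers \<open>2 ^ i\<close> with \<open>i < n\<close> form a basis of the numbers
  below \<open>2 ^ n\<close>; the induction splits off the top bit.\<close>

lemma functional_eqI:
  assumes "functional f" "functional g" "\<And>i. i < n \<Longrightarrow> f (2 ^ i) = g (2 ^ i)" "x < 2 ^ n"
  shows "f x = g x"
  using assms(3,4)
proof (induction n arbitrary: x)
  case 0
  then show ?case using functional_0[OF assms(1)] functional_0[OF assms(2)] by simp
next
  case (Suc n)
  have "f (take_bit n x) = g (take_bit n x)"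
    using Suc by simp
  moreover have "f (2 ^ n) = g (2 ^ n)"
    using Suc by simp
  ultimately show ?case
    using split_top_bit[OF Suc.prems(2)] functional_xor[OF assms(1)] functional_xor[OF assms(2)]
      functional_0[OF assms(1)] functional_0[OF assms(2)]
    by (metis (full_types))
qed

section \<open>Rounds of gates of a single type\<close>

definition round_wf :: "nat \<Rightarrow> round_type \<Rightarrow> gate list \<Rightarrow> bool" where
  "round_wf n t gs \<longleftrightarrow> (\<forall>g\<in>set gs. gate_wf n g \<and> gate_of_type t g)"

lemma round_wf_Nil [simp]: "round_wf n t []"
  and round_wf_Cons [simp]:
    "round_wf n t (g # gs) \<longleftrightarrow> gate_wf n g \<and> gate_of_type t g \<and> round_wf n t gs"
  and round_wf_append [simp]:
    "round_wf n t (gs @ hs) \<longleftrightarrow> round_wf n t gs \<and> round_wf n t hs"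
  and round_wf_rev [simp]: "round_wf n t (rev gs) \<longleftrightarrow> round_wf n t gs"
  by (auto simp: round_wf_def)

lemma round_wf_mono: "round_wf m t gs \<Longrightarrow> m \<le> n \<Longrightarrow> round_wf n t gs"
  by (fastforce simp: round_wf_def gate_wf_def split: gate.splits)

lemma gate_wf_simps [simp]:
  "gate_wf n (Had i) \<longleftrightarrow> i < n"
  "gate_wf n (Phase i) \<longleftrightarrow> i < n"
  "gate_wf n (CNOT a b) \<longleftrightarrow> a < n \<and> b < n \<and> a \<noteq> b"
  by (simp_all add: gate_wf_def)

lemma gate_of_type_cases:
  "gate_of_type RH g \<Longrightarrow> \<exists>i. g = Had i"
  "gate_of_type RP g \<Longrightarrow> \<exists>i. g = Phase i"
  "gate_of_type RC g \<Longrightarrow> \<exists>a b. g = CNOT a b"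
  by (cases g; simp)+

section \<open>CNOT circuits as invertible linear maps; Gaussian elimination\<close>

fun cnot_step :: "gate \<Rightarrow> nat \<Rightarrow> nat" where
  "cnot_step (CNOT a b) x = x XOR (if bit x a then 2 ^ b else 0)"
| "cnot_step _ x = x"

text \<open>The first gate is outermost because circuits act on amplitude vectors by pullback: a
  CNOT circuit sends \<open>f\<close> to \<open>f\<close> composed with this map.\<close>

definition cnot_map :: "gate list \<Rightarrow> nat \<Rightarrow> nat" where
  "cnot_map gs = foldr cnot_step gs"

lemma cnot_map_simps [simp]:
  "cnot_map [] x = x"
  "cnot_map (g # gs) x = cnot_step g (cnot_map gs x)"
  "cnot_map (gs @ hs) x = cnot_map gs (cnot_map hs x)"
  by (simp_all add: cnot_map_def)

lemma cnot_step_xor: "cnot_step g (x XOR y) = cnot_step g x XOR cnot_step g y"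
  by (cases g) (auto simp: bit_xor_iff ac_simps intro!: bit_eqI)

lemma linear_cnot_map: "linear_xor (cnot_map gs)"
  by (induction gs) (auto simp: linear_xor_def cnot_step_xor)

lemma cnot_step_twice: "round_wf n RC [g] \<Longrightarrow> cnot_step g (cnot_step g x) = x"
  by (cases g) (auto simp: bit_xor_iff xor.assoc)

lemma cnot_map_rev: "round_wf n RC gs \<Longrightarrow> cnot_map (rev gs) (cnot_map gs x) = x"
  by (induction gs) (auto simp: cnot_step_twice)

lemma cnot_map_rev': "round_wf n RC gs \<Longrightarrow> cnot_map gs (cnot_map (rev gs) x) = x"
  using cnot_map_rev[of n "rev gs"] by simp

lemma cnot_map_less: "round_wf n RC gs \<Longrightarrow> x < 2 ^ n \<Longrightarrow> cnot_map gs x < 2 ^ n"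
proof (induction gs)
  case (Cons g gs)
  then obtain a b where "g = CNOT a b" using gate_of_type_cases(3)[of g] by auto
  with Cons show ?case by (auto intro!: xor_less_power)
qed simp

text \<open>No gate below qubit \<open>n\<close> is controlled by bit \<open>n\<close>, and all
  lower bits of \<open>2 ^ n\<close> are zero, so no gate fires. This lets a circuit on
  \<open>n\<close> qubits be reused on one more qubit.\<close>

lemma cnot_map_fix: "round_wf n RC gs \<Longrightarrow> cnot_map gs (2 ^ n) = 2 ^ n"
  by (induction gs) (use gate_of_type_cases(3) in fastforce)+

text \<open>All controls lie below \<open>n\<close> and the target is always \<open>n\<close>, so
  the controls stay undisturbed and one CNOT for each \<open>k\<close> with \<open>m (2 ^ k)\<close>
  suffices. This shear serves both the elimination and the completion of the square.\<close>

lemma cnots_into_top: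
  assumes "functional m" "k \<le> n"
  shows "\<exists>hs. round_wf (Suc n) RC hs \<and>
    (\<forall>x. cnot_map hs x = x XOR (if m (take_bit k x) then 2 ^ n else 0))"
  using assms(2)
proof (induction k)
  case 0
  show ?case by (rule exI[of _ "[]"]) (simp add: functional_0[OF assms(1)])
next
  case (Suc k)
  then obtain hs where hs: "round_wf (Suc n) RC hs"
    "\<And>x. cnot_map hs x = x XOR (if m (take_bit k x) then 2 ^ n else 0)" by auto
  have low: "take_bit k (x XOR 2 ^ n) = take_bit k x" for x :: nat
    using Suc.prems by (auto intro!: bit_eqI simp: bit_simps)
  show ?case
    using hs Suc.prems functional_0[OF assms(1)]
    by (intro exI[of _ "hs @ (if m (2 ^ k) then [CNOT k n] else [])"])
       (auto simp: take_bit_Suc_xor functional_xor[OF assms(1)] low)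
qed

text \<open>The transposed shear: bit \<open>n\<close> is the only control, and each set bit of
  \<open>w\<close> contributes one CNOT.\<close>

lemma cnots_from_top:
  assumes "w < 2 ^ k" "k \<le> n"
  shows "\<exists>hs. round_wf (Suc n) RC hs \<and>
    (\<forall>x. cnot_map hs x = x XOR (if bit x n then w else 0))"
  using assms
proof (induction k arbitrary: w)
  case 0
  show ?case by (rule exI[of _ "[]"]) (use 0 in simp)
next
  case (Suc k)
  obtain hs where hs: "round_wf (Suc n) RC hs"
    "\<And>x. cnot_map hs x = x XOR (if bit x n then take_bit k w else 0)"
    using Suc.IH[of "take_bit k w"] Suc.prems(2) by auto
  have *: "w = take_bit k w XOR (if bit w k then 2 ^ k else 0)"
    using split_top_bit Suc.prems(1) .
  show ?case
  proof (cases "bit w k")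
    case True
    then have w: "w = 2 ^ k XOR take_bit k w" using * by (simp add: xor.commute)
    show ?thesis
      using hs Suc.prems(2)
      by (intro exI[of _ "hs @ [CNOT n k]"])
         (auto simp: bit_xor_iff xor.assoc w[symmetric])
  next
    case False
    then show ?thesis using hs * by auto
  qed
qed

text \<open>Gaussian elimination on the top bit. A circuit \<open>g\<close> after \<open>L\<close>
  makes the image of \<open>2 ^ n\<close> equal to \<open>2 ^ n\<close>; a shear \<open>h\<close>
  before it removes bit \<open>n\<close> from the images of the lower vectors. What remains acts on
  \<open>n\<close> bits with trivial kernel.\<close>

lemma linear_as_cnots:
  assumes "linear_xor L" "\<And>x. x < 2 ^ n \<Longrightarrow> L x < 2 ^ n"
    "\<And>x. x < 2 ^ n \<Longrightarrow> L x = 0 \<Longrightarrow> x = 0"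
  shows "\<exists>gs. round_wf n RC gs \<and> (\<forall>x<2 ^ n. cnot_map gs x = L x)"
  using assms
proof (induction n arbitrary: L)
  case 0
  then show ?case by (intro exI[of _ "[]"]) (simp add: linear_xor_0)
next
  case (Suc n)
  note lin = Suc.prems(1)
  have top: "(2::nat) ^ n < 2 ^ Suc n" by simp
  define w where "w = L (2 ^ n)"
  have w: "w < 2 ^ Suc n" "w \<noteq> 0"
    using Suc.prems(2)[OF top] Suc.prems(3)[OF top] by (auto simp: w_def)
  \<comment> \<open>The pivot: if bit \<open>n\<close> of \<open>w\<close> is clear, some lower bit
    \<open>k\<close> is set and is added into bit \<open>n\<close>.\<close>
  obtain g1 where g1: "round_wf (Suc n) RC g1" "bit (cnot_map g1 w) n"
  proof (cases "bit w n")
    case True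
    then show ?thesis using that[of "[]"] by simp
  next
    case False
    obtain k where k: "bit w k" using w(2) by (metis bit_eqI bit_0_eq bot_apply bot_bool_def)
    then have "k < n"
      using False w(1) bit_above_nat by (metis less_antisym not_less)
    then show ?thesis using that[of "[CNOT k n]"] k False by (simp add: bit_xor_iff)
  qed
  let ?w' = "cnot_map g1 w"
  \<comment> \<open>With the pivot in place, XOR with the lower part of the vector clears all its
    lower bits.\<close>
  obtain g2 where g2: "round_wf (Suc n) RC g2"
    "\<And>x. cnot_map g2 x = x XOR (if bit x n then take_bit n ?w' else 0)"
    using cnots_from_top[of "take_bit n ?w'" n n] by auto
  define g where "g = g2 @ g1"
  have g: "round_wf (Suc n) RC g" using g1 g2 by (simp add: g_def)
  have "?w' = take_bit n ?w' XOR 2 ^ n"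
    using split_top_bit[OF cnot_map_less[OF g1(1) w(1)]] g1(2) by simp
  then have gw: "cnot_map g w = 2 ^ n"
    using g1(2) by (simp add: g_def g2(2)) (metis xor.commute xor_double_cancel)
  define K where "K = (\<lambda>x. cnot_map g (L x))"
  have K: "linear_xor K" "\<And>x. x < 2 ^ Suc n \<Longrightarrow> K x < 2 ^ Suc n" "K (2 ^ n) = 2 ^ n"
    using linear_xor_compose[OF linear_cnot_map lin] Suc.prems(2) cnot_map_less[OF g] gw
    by (auto simp: K_def w_def)
  have K0: "x = 0" if "x < 2 ^ Suc n" "K x = 0" for x
  proof -
    have "L x = cnot_map (rev g) 0"
      using cnot_map_rev[OF g, of "L x"] that(2) by (simp add: K_def)
    then show ?thesis using Suc.prems(3)[OF that(1)] linear_xor_0[OF linear_cnot_map] by simp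
  qed
  have "functional (\<lambda>x. bit (K x) n)"
    using functional_compose[OF functional_bit K(1)] .
  \<comment> \<open>Since \<open>K\<close> fixes \<open>2 ^ n\<close>, adding \<open>2 ^ n\<close>
    to those lower vectors whose image has bit \<open>n\<close> set clears that bit of the
    image.\<close>
  then obtain h where h: "round_wf (Suc n) RC h"
    "\<And>x. cnot_map h x = x XOR (if bit (K (take_bit n x)) n then 2 ^ n else 0)"
    using cnots_into_top[of _ n n] by auto
  define J where "J = (\<lambda>x. K (cnot_map h x))"
  have J: "linear_xor J" using linear_xor_compose[OF K(1) linear_cnot_map] by (simp add: J_def)
  have h_less: "cnot_map h x < 2 ^ Suc n" if "x < 2 ^ Suc n" for x
    using cnot_map_less[OF h(1) that] .
  have J_less: "J x < 2 ^ n" if "x < 2 ^ n" for x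
  proof (rule less_power_Suc)
    show "J x < 2 ^ Suc n"
      unfolding J_def using K(2)[OF h_less] that by simp
    have "J x = K x XOR (if bit (K x) n then 2 ^ n else 0)"
      using that K(3) by (simp add: J_def h(2) linear_xorD[OF K(1)] linear_xor_0[OF K(1)] take_bit_nat_eq_self)
    then show "\<not> bit (J x) n" by (auto simp: bit_xor_iff)
  qed
  have J0: "x = 0" if "x < 2 ^ n" "J x = 0" for x
  proof -
    have "cnot_map h x = 0" using K0[OF h_less] that by (simp add: J_def)
    then show ?thesis
      using cnot_map_rev[OF h(1), of x] linear_xor_0[OF linear_cnot_map] by simp
  qed
  obtain j where j: "round_wf n RC j" "\<And>x. x < 2 ^ n \<Longrightarrow> cnot_map j x = J x"
    using Suc.IH[OF J J_less J0] by blast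
  have J_top: "J (2 ^ n) = 2 ^ n"
    using K(3) by (simp add: J_def h(2) linear_xor_0[OF K(1)] take_bit_eq_mod)
  \<comment> \<open>Both maps are linear and fix \<open>2 ^ n\<close>, so agreement below
    \<open>2 ^ n\<close> extends to one more bit.\<close>
  have jJ: "cnot_map j x = J x" if x: "x < 2 ^ Suc n" for x
  proof -
    define y where "y = take_bit n x"
    have "x = y XOR (if bit x n then 2 ^ n else 0)" "y < 2 ^ n"
      using split_top_bit[OF x] by (simp_all add: y_def)
    moreover have "cnot_map j (y XOR 2 ^ n) = J (y XOR 2 ^ n)"
      using j(2)[OF \<open>y < 2 ^ n\<close>] cnot_map_fix[OF j(1)] J_top
      by (simp add: linear_xorD[OF J] linear_xorD[OF linear_cnot_map])
    ultimately show ?thesis using j(2) by (cases "bit x n") auto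
  qed
  \<comment> \<open>By construction \<open>J\<close> is \<open>g\<close> after \<open>L\<close>
    after \<open>h\<close>; reversing a CNOT circuit inverts it, which solves for
    \<open>L\<close>.\<close>
  have "cnot_map (rev g @ j @ rev h) x = L x" if "x < 2 ^ Suc n" for x
  proof -
    have "cnot_map j (cnot_map (rev h) x) = J (cnot_map (rev h) x)"
      using jJ cnot_map_less[of "Suc n" "rev h"] h(1) that by simp
    also have "\<dots> = cnot_map g (L x)"
      using cnot_map_rev'[OF h(1)] by (simp add: J_def K_def)
    finally show ?thesis using cnot_map_rev[OF g] by simp
  qed
  moreover have "round_wf (Suc n) RC (rev g @ j @ rev h)"
    using g h(1) j(1) round_wf_mono[of n RC j "Suc n"] by simp
  ultimately show ?case by blast
qed


section \<open>Quadratic functions with values in the fourth roots of unity\<close>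

definition sign :: "bool \<Rightarrow> complex" where
  "sign b = (if b then - 1 else 1)"

lemma sign_simps [simp]: "sign True = - 1" "sign False = 1"
  by (simp_all add: sign_def)

text \<open>This is i to the power of a quadratic form with values in Z/4, and \<open>\<phi>\<close>
  is its polar form over F_2. The form \<open>\<phi>\<close> is symmetric but need not be
  alternating: \<open>\<phi> x x\<close> tells whether \<open>q x\<close> is one of i, -i or one of
  1, -1.\<close>

definition quadratic_with :: "(nat \<Rightarrow> complex) \<Rightarrow> (nat \<Rightarrow> nat \<Rightarrow> bool) \<Rightarrow> bool" where
  "quadratic_with q \<phi> \<longleftrightarrow> (\<forall>x. functional (\<phi> x)) \<and> (\<forall>x y. \<phi> x y = \<phi> y x) \<and>
     q 0 = 1 \<and> (\<forall>x y. q (x XOR y) = q x * q y * sign (\<phi> x y))"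

definition quadratic :: "(nat \<Rightarrow> complex) \<Rightarrow> bool" where
  "quadratic q \<longleftrightarrow> (\<exists>\<phi>. quadratic_with q \<phi>)"

lemma quadratic_withD:
  assumes "quadratic_with q \<phi>"
  shows "functional (\<phi> x)" "functional (\<lambda>x. \<phi> x y)" "\<phi> x y = \<phi> y x" "q 0 = 1"
    "q (x XOR y) = q x * q y * sign (\<phi> x y)"
  using assms unfolding quadratic_with_def functional_def by metis+

lemma quadratic_with_square: "quadratic_with q \<phi> \<Longrightarrow> q x * q x = sign (\<phi> x x)"
  using quadratic_withD(4)[of q \<phi>] quadratic_withD(5)[of q \<phi> x x]
  by (cases "\<phi> x x") (auto simp: minus_equation_iff[of "q x * q x"])

lemma quadratic_power4:
  assumes "quadratic q"
  shows "q x ^ 4 = 1"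
proof -
  from assms obtain \<phi> where "quadratic_with q \<phi>" by (auto simp: quadratic_def)
  then have "(q x * q x) * (q x * q x) = 1"
    by (cases "\<phi> x x") (simp_all add: quadratic_with_square)
  then show ?thesis by (simp add: power4_eq_xxxx mult.assoc)
qed

lemma norm_fourth_root: "z ^ 4 = 1 \<Longrightarrow> cmod z = 1"
  by (metis norm_ge_zero norm_one norm_power power_eq_1_iff zero_neq_numeral)

lemma quadratic_mult:
  assumes "quadratic p" "quadratic q"
  shows "quadratic (\<lambda>x. p x * q x)"
proof -
  obtain \<phi> \<psi> where *: "quadratic_with p \<phi>" "quadratic_with q \<psi>"
    using assms by (auto simp: quadratic_def)
  have "quadratic_with (\<lambda>x. p x * q x) (\<lambda>x y. \<phi> x y \<noteq> \<psi> x y)"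
    unfolding quadratic_with_def
    using quadratic_withD[OF *(1)] quadratic_withD[OF *(2)]
      functional_neq[OF quadratic_withD(1)[OF *(1)] quadratic_withD(1)[OF *(2)]]
    by (auto simp: sign_def)
  then show ?thesis by (auto simp: quadratic_def)
qed

lemma quadratic_compose:
  assumes "quadratic q" "linear_xor L"
  shows "quadratic (\<lambda>x. q (L x))"
proof -
  obtain \<phi> where *: "quadratic_with q \<phi>"
    using assms by (auto simp: quadratic_def)
  have "quadratic_with (\<lambda>x. q (L x)) (\<lambda>x y. \<phi> (L x) (L y))"
    unfolding quadratic_with_def
    using quadratic_withD[OF *] linear_xorD[OF assms(2)] linear_xor_0[OF assms(2)]
      functional_compose[OF _ assms(2)]
    by auto
  then show ?thesis by (auto simp: quadratic_def)
qed

lemma fourth_root_cases: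
  fixes w :: complex
  assumes "w ^ 4 = 1"
  shows "w = 1 \<or> w = - 1 \<or> w = \<i> \<or> w = - \<i>"
proof -
  have "(w\<^sup>2)\<^sup>2 = 1" using assms by (simp flip: power_mult)
  then have "w\<^sup>2 = 1\<^sup>2 \<or> w\<^sup>2 = \<i>\<^sup>2"
    using power2_eq_iff[of "w\<^sup>2" 1] by simp
  then show ?thesis unfolding power2_eq_iff by blast
qed

text \<open>If \<open>f x\<close> and \<open>f y\<close> both hold, then \<open>f\<close> fails at
  \<open>x XOR y\<close>, so the polar form must cancel \<open>w * w\<close>. This is a sign since
  \<open>w\<close> is a fourth root of unity.\<close>

lemma quadratic_root:
  assumes "functional f" "w ^ 4 = 1"
  shows "quadratic (\<lambda>x. if f x then w else 1)"
proof -
  have "w * w = 1 \<or> w * w = - 1"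
    using fourth_root_cases[OF assms(2)] by auto
  then have "quadratic_with (\<lambda>x. if f x then w else 1) (\<lambda>x y. f x \<and> f y \<and> w * w = - 1)"
    unfolding quadratic_with_def
    using functional_0[OF assms(1)] assms(1) by (auto simp: functional_def)
  then show ?thesis by (auto simp: quadratic_def)
qed

lemma quadratic_sign: "functional f \<Longrightarrow> quadratic (\<lambda>x. sign (f x))"
  unfolding sign_def by (rule quadratic_root) simp_all

text \<open>The polar form of a product of two functionals is its symmetrization f(x) g(y) + f(y)
  g(x).\<close>

lemma quadratic_sign_conj:
  assumes "functional f" "functional g"
  shows "quadratic (\<lambda>x. sign (f x \<and> g x))"
proof -
  have "quadratic_with (\<lambda>x. sign (f x \<and> g x)) (\<lambda>x y. (f x \<and> g y) \<noteq> (f y \<and> g x))"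
    unfolding quadratic_with_def
    using functional_0[OF assms(1)] assms by (auto simp: functional_def sign_def)
  then show ?thesis by (auto simp: quadratic_def)
qed

section \<open>The action of gates on amplitude vectors indexed by all naturals\<close>

fun act :: "gate \<Rightarrow> (nat \<Rightarrow> complex) \<Rightarrow> nat \<Rightarrow> complex" where
  "act (Had i) f x = (sign (bit x i) * f x + f (x XOR 2 ^ i)) / complex_of_real (sqrt 2)"
| "act (Phase i) f x = (if bit x i then \<i> else 1) * f x"
| "act (CNOT a b) f x = f (cnot_step (CNOT a b) x)"

lemma act_scale: "act g (\<lambda>x. k * f x) x = k * act g f x"
  by (cases g) (simp_all add: algebra_simps)

lemma act_cong:
  assumes "gate_wf n g" "\<And>x. x < 2 ^ n \<Longrightarrow> f x = f' x" "x < 2 ^ n"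
  shows "act g f x = act g f' x"
  using assms by (cases g) (auto simp: xor_less_power)

lemma fold_act_cong:
  assumes "circuit_wf n gs" "\<And>x. x < 2 ^ n \<Longrightarrow> f x = f' x" "x < 2 ^ n"
  shows "fold act gs f x = fold act gs f' x"
  using assms
proof (induction gs arbitrary: f f')
  case (Cons g gs)
  have "act g f y = act g f' y" if "y < 2 ^ n" for y
    using act_cong[of n g f f' y] Cons.prems(1,2) that by (simp add: circuit_wf_def)
  then show ?case
    using Cons.IH[of "act g f" "act g f'"] Cons.prems(1,3) by (simp add: circuit_wf_def)
qed simp

lemma fold_act_cnots: "round_wf n RC gs \<Longrightarrow> fold act gs f = (\<lambda>x. f (cnot_map gs x))"
proof (induction gs arbitrary: f)
  case (Cons g gs)
  then obtain a b where "g = CNOT a b" using gate_of_type_cases(3)[of g] by auto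
  with Cons show ?case by (simp add: fun_eq_iff)
qed simp

section \<open>Diagonals of phase circuits, and completing the square\<close>

definition phase_factor :: "gate list \<Rightarrow> nat \<Rightarrow> complex" where
  "phase_factor ps = fold act ps (\<lambda>_. 1)"

lemma fold_act_phases:
  "round_wf n RP ps \<Longrightarrow> fold act ps f = (\<lambda>x. phase_factor ps x * f x)"
proof (induction ps arbitrary: f)
  case (Cons g ps)
  then obtain i where g: "g = Phase i" using gate_of_type_cases(2)[of g] by auto
  have "fold act ps (act g h) = (\<lambda>x. phase_factor ps x * act g h x)" for h
    using Cons by simp
  then show ?case by (simp add: phase_factor_def g fun_eq_iff algebra_simps)
qed (simp add: phase_factor_def)

lemma phase_factor_append:
  "round_wf n RP qs \<Longrightarrow> phase_factor (ps @ qs) x = phase_factor qs x * phase_factor ps x"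
  using fold_act_phases[of n qs "phase_factor ps"] by (simp add: phase_factor_def)

lemma phase_factor_replicate:
  "phase_factor (replicate k (Phase i)) x = (if bit x i then \<i> ^ k else 1)"
proof (induction k)
  case (Suc k)
  have "round_wf (Suc i) RP [Phase i]" by simp
  then have "phase_factor (replicate k (Phase i) @ [Phase i]) x
     = phase_factor [Phase i] x * phase_factor (replicate k (Phase i)) x"
    by (rule phase_factor_append)
  then show ?case using Suc by (simp add: replicate_append_same phase_factor_def)
qed (simp add: phase_factor_def)

lemma phase_factor_local:
  "round_wf n RP ps \<Longrightarrow> phase_factor ps (x XOR (if b then 2 ^ n else 0)) = phase_factor ps x"
proof (induction ps rule: rev_induct)
  case (snoc g ps)
  then obtain i where "g = Phase i" using gate_of_type_cases(2)[of g] by auto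
  with snoc show ?case
    by (auto simp: phase_factor_append[of n] phase_factor_def bit_xor_iff)
qed (simp add: phase_factor_def)

lemma fourth_root_power_i:
  assumes "w ^ 4 = 1"
  shows "\<exists>k. w = \<i> ^ k"
proof -
  note fourth_root_cases[OF assms]
  moreover have "1 = \<i> ^ 0" "- 1 = \<i> ^ 2" "\<i> = \<i> ^ 1" "- \<i> = \<i> ^ 3"
    by (simp_all add: power3_eq_cube)
  ultimately show ?thesis by metis
qed

text \<open>Completes the square in the top variable \<open>b\<close>, whose cross terms with the other variables
  form the functional \<open>m\<close>: \<open>\<i>\<close> to the power \<open>b \<oplus> m\<close> equals \<open>\<i>\<close> to the power \<open>b + m + 2 b m\<close>.\<close>

lemma quadratic_decompose:
  assumes "quadratic q"
  shows "\<exists>gs ps. round_wf n RC gs \<and> round_wf n RP ps \<and>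
    (\<forall>x<2 ^ n. q x = phase_factor (map Phase [0..<n]) (cnot_map gs x) * phase_factor ps x)"
  using assms
proof (induction n arbitrary: q)
  case 0
  then obtain \<phi> where "quadratic_with q \<phi>" by (auto simp: quadratic_def)
  then show ?case
    by (intro exI[of _ "[]"]) (simp add: phase_factor_def quadratic_withD(4))
next
  case (Suc n)
  then obtain \<phi> where \<phi>: "quadratic_with q \<phi>" by (auto simp: quadratic_def)
  define m where "m = \<phi> (2 ^ n)"
  have m: "functional m" unfolding m_def using quadratic_withD(1)[OF \<phi>] .
  \<comment> \<open>The phase gate on the sheared top bit contributes i to the power b xor m, also
    when b is 0. Its factor i to the power m is divided out before the induction hypothesis treats
    the lower bits.\<close>
  define q' where "q' = (\<lambda>x. q x * (if m x then - \<i> else 1))"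
  have "quadratic q'"
    unfolding q'_def using Suc.prems quadratic_root[OF m, of "- \<i>"]
    by (intro quadratic_mult) (simp_all add: power4_eq_xxxx)
  from Suc.IH[OF this] obtain gs ps where gs: "round_wf n RC gs" and ps: "round_wf n RP ps"
    and q': "\<And>x. x < 2 ^ n \<Longrightarrow>
      q' x = phase_factor (map Phase [0..<n]) (cnot_map gs x) * phase_factor ps x" by blast
  obtain hs where hs: "round_wf (Suc n) RC hs"
    "\<And>x. cnot_map hs x = x XOR (if m (take_bit n x) then 2 ^ n else 0)"
    using cnots_into_top[OF m, of n n] by auto
  \<comment> \<open>Of the factor \<open>q (2 ^ n)\<close> belonging to the top bit, one i comes
    from the phase gate between the CNOT rounds; the rest is a power of i, supplied by
    \<open>k\<close> phase gates on qubit \<open>n\<close>.\<close>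
  have "(q (2 ^ n) * (- \<i>)) ^ 4 = 1"
    using quadratic_power4[OF Suc.prems] by (simp add: power_mult_distrib)
  then obtain k where k: "q (2 ^ n) * (- \<i>) = \<i> ^ k" using fourth_root_power_i by blast
  then have qn: "q (2 ^ n) = \<i> * \<i> ^ k" by (simp flip: k add: mult.left_commute[of \<i>])
  let ?ps = "ps @ replicate k (Phase n)"
  have rep: "round_wf (Suc n) RP (replicate k (Phase n))" by (simp add: round_wf_def)
  have "q x = phase_factor (map Phase [0..<Suc n]) (cnot_map (gs @ hs) x) * phase_factor ?ps x"
    if x: "x < 2 ^ Suc n" for x
  proof -
    define y where "y = take_bit n x"
    define b where "b = bit x n"
    have y: "y < 2 ^ n" by (simp add: y_def)
    have x_eq: "x = y XOR (if b then 2 ^ n else 0)"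
      using split_top_bit[OF x] by (simp add: y_def b_def)
    have "cnot_map hs x = y XOR (if b \<noteq> m y then 2 ^ n else 0)"
      unfolding hs(2) y_def[symmetric] by (auto simp: x_eq xor.assoc)
    then have map_x: "cnot_map (gs @ hs) x = cnot_map gs y XOR (if b \<noteq> m y then 2 ^ n else 0)"
      using linear_xorD[OF linear_cnot_map, of gs y "2 ^ n"] cnot_map_fix[OF gs] by simp
    have top: "phase_factor (map Phase [0..<Suc n]) z
      = (if bit z n then \<i> else 1) * phase_factor (map Phase [0..<n]) z" for z
      by (simp add: phase_factor_def)
    have all: "round_wf n RP (map Phase [0..<n])" by (auto simp: round_wf_def)
    have bit_z: "bit (cnot_map gs y XOR (if b \<noteq> m y then 2 ^ n else 0)) n = (b \<noteq> m y)"
      using bit_above_nat[OF cnot_map_less[OF gs y], of n] by (simp add: bit_xor_iff)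
    have "phase_factor (map Phase [0..<Suc n]) (cnot_map (gs @ hs) x)
      = (if b \<noteq> m y then \<i> else 1) * phase_factor (map Phase [0..<n]) (cnot_map gs y)"
      unfolding map_x top bit_z phase_factor_local[OF all] ..
    moreover have "phase_factor ?ps x = (if b then \<i> ^ k else 1) * phase_factor ps y"
      using phase_factor_local[OF ps, of y b]
      by (simp add: phase_factor_append[OF rep] phase_factor_replicate b_def x_eq[unfolded b_def, symmetric])
    moreover have "q x = (if b then q (2 ^ n) * sign (m y) else 1) * q y"
      using quadratic_withD(5)[OF \<phi>, of y "2 ^ n"] quadratic_withD(3)[OF \<phi>, of y "2 ^ n"]
      by (simp add: x_eq m_def)
    moreover have "q y = (if m y then \<i> else 1) * q' y" by (simp add: q'_def)
    ultimately show ?thesis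
      using q'[OF y] by (auto simp: qn sign_def)
  qed
  moreover have "round_wf (Suc n) RC (gs @ hs)" "round_wf (Suc n) RP ?ps"
    using round_wf_mono[OF gs, of "Suc n"] round_wf_mono[OF ps, of "Suc n"] hs(1) rep by simp_all
  ultimately show ?case by blast
qed

section \<open>Gates acting on quadratic functions; Gauss sums\<close>

lemma act_phase_quadratic:
  assumes "quadratic q"
  shows "quadratic (act (Phase i) q)"
proof -
  have "act (Phase i) q = (\<lambda>x. (if bit x i then \<i> else 1) * q x)" by (rule ext) simp
  then show ?thesis
    using quadratic_mult[OF quadratic_root[OF functional_bit, of "\<i>" i] assms]
    by (simp add: power4_eq_xxxx)
qed

lemma act_cnot_quadratic:
  assumes "quadratic q"
  shows "quadratic (act (CNOT a b) q)"
proof -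
  have "act (CNOT a b) q = (\<lambda>x. q (cnot_map [CNOT a b] x))" by (rule ext) simp
  then show ?thesis using quadratic_compose[OF assms linear_cnot_map[of "[CNOT a b]"]] by simp
qed

text \<open>Here u = \<open>q (2 ^ i)\<close> is i or -i, so 1 - u = (1 + u)(-u). Hence the sum of
  two terms is always 1 + u, of modulus sqrt 2, times a fourth root of unity that depends
  quadratically on \<open>x\<close>.\<close>

lemma act_had_odd:
  assumes q: "quadratic_with q \<phi>" and odd: "\<phi> (2 ^ i) (2 ^ i)"
  shows "\<exists>k q'. cmod k = 1 \<and> quadratic q' \<and> (\<forall>x. act (Had i) q x = k * q' x)"
proof -
  define u where "u = q (2 ^ i)"
  have uu: "u * u = - 1" using quadratic_with_square[OF q, of "2 ^ i"] odd by (simp add: u_def)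
  have u4: "u ^ 4 = 1" using quadratic_power4 q by (auto simp: u_def quadratic_def)
  define f where "f = (\<lambda>x. bit x i \<noteq> \<phi> x (2 ^ i))"
  have f: "functional f"
    unfolding f_def by (intro functional_neq functional_bit quadratic_withD(2)[OF q])
  define q' where "q' = (\<lambda>x. q x * (sign (bit x i) * (if f x then - u else 1)))"
  have "quadratic q'"
    unfolding q'_def using q f u4
    by (intro quadratic_mult quadratic_sign quadratic_root functional_bit) (auto simp: quadratic_def)
  moreover have "act (Had i) q x = (1 + u) / complex_of_real (sqrt 2) * q' x" for x
  proof -
    have "1 + u * u = 0" using uu by simp
    then have "sign (bit x i) + u * sign (\<phi> x (2 ^ i))
      = (1 + u) * (sign (bit x i) * (if f x then - u else 1))"
      by (cases "bit x i"; cases "\<phi> x (2 ^ i)") (simp_all add: f_def algebra_simps)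
    then have "sign (bit x i) * q x + q (x XOR 2 ^ i) = (1 + u) * q' x"
      unfolding quadratic_withD(5)[OF q, of x] q'_def u_def[symmetric]
      by (metis (no_types, lifting) distrib_right mult.assoc mult.commute)
    then show ?thesis by simp
  qed
  moreover have "cmod ((1 + u) / complex_of_real (sqrt 2)) = 1"
    using fourth_root_cases[OF u4] uu by (auto simp: norm_divide cmod_def power_divide)
  ultimately show ?thesis by blast
qed

text \<open>With u = 1 or u = -1 the sum over bit \<open>i\<close> is twice a sign or zero. The
  coupling \<open>ij\<close> reverses the relative sign of its two terms when bit \<open>j\<close>
  is flipped, so exactly one of the two terms of the sum over bit \<open>j\<close> survives.\<close>

lemma act_had_had_even:
  assumes q: "quadratic_with q \<phi>" and even: "\<not> \<phi> (2 ^ i) (2 ^ i)" and ij: "\<phi> (2 ^ i) (2 ^ j)"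
  shows "\<exists>k q'. cmod k = 1 \<and> quadratic q' \<and> (\<forall>x. act (Had j) (act (Had i) q) x = k * q' x)"
proof -
  have neq: "i \<noteq> j" using even ij by auto
  define u where "u = q (2 ^ i)"
  define w where "w = q (2 ^ j)"
  have "u * u = 1" using quadratic_with_square[OF q, of "2 ^ i"] even by (simp add: u_def)
  then have u: "u = 1 \<or> u = - 1" using square_eq_1_iff by blast
  have w4: "w ^ 4 = 1" using quadratic_power4 q by (auto simp: w_def quadratic_def)
  then have w0: "w \<noteq> 0" by auto
  define f where "f = (\<lambda>x. bit x i \<noteq> \<phi> x (2 ^ i))"
  define g where "g = (\<lambda>x. bit x j \<noteq> \<phi> x (2 ^ j))"
  have f: "functional f" and g: "functional g"
    unfolding f_def g_def by (intro functional_neq functional_bit quadratic_withD(2)[OF q])+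
  have s2: "complex_of_real (sqrt 2) * complex_of_real (sqrt 2) = 2"
    by (simp flip: of_real_mult)
  have had: "act (Had j) (act (Had i) q) x =
    q x * (sign (bit x j) * (sign (bit x i) + u * sign (\<phi> x (2 ^ i)))
     + w * sign (\<phi> x (2 ^ j)) * (sign (bit x i) - u * sign (\<phi> x (2 ^ i)))) / 2" for x
  proof -
    have *: "act (Had i) q y = q y * (sign (bit y i) + u * sign (\<phi> y (2 ^ i))) / complex_of_real (sqrt 2)" for y
      by (simp add: quadratic_withD(5)[OF q] u_def algebra_simps)
    have "\<phi> (x XOR 2 ^ j) (2 ^ i) = (\<not> \<phi> x (2 ^ i))"
      using functional_xor[OF quadratic_withD(2)[OF q]] ij quadratic_withD(3)[OF q] by blast
    then have **: "sign (\<phi> (x XOR 2 ^ j) (2 ^ i)) = - sign (\<phi> x (2 ^ i))"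
      by (simp add: sign_def)
    have "bit (x XOR 2 ^ j) i = bit x i" using neq by (simp add: bit_xor_iff)
    then have "act (Had i) q (x XOR 2 ^ j) = q x * w * sign (\<phi> x (2 ^ j)) *
        (sign (bit x i) - u * sign (\<phi> x (2 ^ i))) / complex_of_real (sqrt 2)"
      unfolding * ** quadratic_withD(5)[OF q] by (simp add: w_def)
    then have "act (Had j) (act (Had i) q) x = (sign (bit x j) * (q x * (sign (bit x i) + u * sign (\<phi> x (2 ^ i))))
      + q x * w * sign (\<phi> x (2 ^ j)) * (sign (bit x i) - u * sign (\<phi> x (2 ^ i))))
      / (complex_of_real (sqrt 2) * complex_of_real (sqrt 2))"
      unfolding act.simps(1)[of j] * by (simp add: add_divide_distrib)
    then show ?thesis unfolding s2 by (simp add: algebra_simps)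
  qed
  have quad: "quadratic q" using q by (auto simp: quadratic_def)
  show ?thesis
  proof (cases "u = 1")
    case True
    \<comment> \<open>For u = 1 the unflipped term survives when \<open>f x\<close> fails and the
      flipped one, with factor \<open>w\<close>, when it holds. The factor
      \<open>sign (f x \<and> g x)\<close> replaces the sign of bit \<open>j\<close> by that of
      \<open>\<phi> x (2 ^ j)\<close> in the second case.\<close>
    define q' where "q' = (\<lambda>x. q x * (sign (bit x i) * (sign (bit x j) *
      ((if f x then w else 1) * sign (f x \<and> g x)))))"
    have "quadratic q'"
      unfolding q'_def using quad f g w4
      by (intro quadratic_mult quadratic_sign quadratic_root quadratic_sign_conj functional_bit) auto
    moreover have "act (Had j) (act (Had i) q) x = 1 * q' x" for x
      unfolding had q'_def f_def g_def
      by (cases "bit x i"; cases "bit x j"; cases "\<phi> x (2 ^ i)"; cases "\<phi> x (2 ^ j)")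
        (simp_all add: True)
    ultimately show ?thesis by (metis norm_one)
  next
    case False
    then have u': "u = - 1" using u by simp
    \<comment> \<open>For u = -1 the two cases are exchanged. The factor \<open>w\<close> is pulled
      out as the constant, so that the value at 0 is 1, and \<open>inverse w\<close> undoes it where
      \<open>f x\<close> holds.\<close>
    define q' where "q' = (\<lambda>x. q x * (sign (bit x i) * (sign (\<phi> x (2 ^ j)) *
      ((if f x then inverse w else 1) * sign (f x \<and> g x)))))"
    have "quadratic q'"
      unfolding q'_def using quad f g w4
      by (intro quadratic_mult quadratic_sign quadratic_root quadratic_sign_conj functional_bit
          quadratic_withD(2)[OF q]) (auto simp: power_inverse)
    moreover have "act (Had j) (act (Had i) q) x = w * q' x" for x
      unfolding had q'_def f_def g_def
      by (cases "bit x i"; cases "bit x j"; cases "\<phi> x (2 ^ i)"; cases "\<phi> x (2 ^ j)")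
        (simp_all add: u' w0)
    ultimately show ?thesis using norm_fourth_root[OF w4] by blast
  qed
qed

section \<open>Matrix entries of circuits\<close>

lemma gate_mat_carrier [simp]: "gate_mat n g \<in> carrier_mat (2 ^ n) (2 ^ n)"
  by (cases g) (simp_all add: gate_mat_def)

lemma circuit_mat_snoc [simp]: "circuit_mat n (gs @ [g]) = gate_mat n g * circuit_mat n gs"
  by (simp add: circuit_mat_def)

lemma circuit_mat_Nil [simp]: "circuit_mat n [] = 1\<^sub>m (2 ^ n)"
  by (simp add: circuit_mat_def)

lemma circuit_mat_carrier [simp]: "circuit_mat n gs \<in> carrier_mat (2 ^ n) (2 ^ n)"
proof (induction gs rule: rev_induct)
  case (snoc g gs)
  then show ?case using mult_carrier_mat[OF gate_mat_carrier] by simp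
qed simp

lemma circuit_mat_append: "circuit_mat n (gs @ hs) = circuit_mat n hs * circuit_mat n gs"
proof (induction hs rule: rev_induct)
  case Nil
  show ?case using left_mult_one_mat[OF circuit_mat_carrier] by simp
next
  case (snoc h hs)
  have "circuit_mat n (gs @ hs @ [h]) = gate_mat n h * circuit_mat n (gs @ hs)"
    using circuit_mat_snoc[of n "gs @ hs" h] by simp
  also have "\<dots> = gate_mat n h * circuit_mat n hs * circuit_mat n gs"
    using snoc assoc_mult_mat[OF gate_mat_carrier circuit_mat_carrier circuit_mat_carrier]
    by simp
  finally show ?case by simp
qed

lemma sum_two_points:
  fixes f :: "nat \<Rightarrow> 'a :: comm_monoid_add"
  assumes "a < N" "b < N" "a \<noteq> b" "\<And>k. k < N \<Longrightarrow> k \<noteq> a \<Longrightarrow> k \<noteq> b \<Longrightarrow> f k = 0"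
  shows "(\<Sum>k = 0..<N. f k) = f a + f b"
proof -
  have "(\<Sum>k = 0..<N. f k) = sum f {a, b}"
    using assms by (intro sum.mono_neutral_right) auto
  then show ?thesis using assms(3) by simp
qed

lemma xor_power_neq: "x XOR 2 ^ i \<noteq> x" for x :: nat
  by (metis power_not_zero xor.assoc xor.left_neutral xor.right_neutral xor_self_eq zero_neq_numeral)

text \<open>Multiplication from the left treats every column as an amplitude vector, which reduces
  matrix products to \<open>act\<close>.\<close>

lemma gate_mat_mult_entry:
  assumes g: "gate_wf n g" and U: "U \<in> carrier_mat (2 ^ n) (2 ^ n)" and rc: "r < 2 ^ n" "c < 2 ^ n"
  shows "(gate_mat n g * U) $$ (r, c) = act g (\<lambda>k. U $$ (k, c)) r"
proof -
  have G: "gate_mat n g \<in> carrier_mat (2 ^ n) (2 ^ n)" by simp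
  have *: "(gate_mat n g * U) $$ (r, c) = (\<Sum>k = 0..<2 ^ n. gate_mat n g $$ (r, k) * U $$ (k, c))"
    using carrier_matD[OF G] carrier_matD[OF U] rc by (simp add: scalar_prod_def)
  show ?thesis
  proof (cases g)
    case (Had i)
    then have "r XOR 2 ^ i < 2 ^ n" using g rc by (simp add: xor_less_power)
    then have "(gate_mat n g * U) $$ (r, c) = gate_mat n g $$ (r, r) * U $$ (r, c)
       + gate_mat n g $$ (r, r XOR 2 ^ i) * U $$ (r XOR 2 ^ i, c)"
      unfolding * using Had rc xor_power_neq[of r i]
      by (intro sum_two_points) (auto simp: gate_mat_def flip_bit_eq_xor)
    then show ?thesis using Had rc \<open>r XOR 2 ^ i < 2 ^ n\<close> xor_power_neq[of r i]
      by (simp add: gate_mat_def flip_bit_eq_xor qbit_eq_bit sign_def bit_xor_iff add_divide_distrib)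
  next
    case (Phase i)
    have "(gate_mat n g * U) $$ (r, c) = (\<Sum>k = 0..<2 ^ n. if k = r then (if bit r i then \<i> else 1) * U $$ (k, c) else 0)"
      unfolding * using Phase rc by (intro sum.cong) (auto simp: gate_mat_def qbit_eq_bit)
    then show ?thesis using Phase rc by simp
  next
    case (CNOT a b)
    have step: "(if qbit k a then flip_bit k b else k) = cnot_step g k" for k
      using CNOT by (simp add: qbit_eq_bit flip_bit_eq_xor)
    have wf: "round_wf n RC [g]" using g CNOT by simp
    \<comment> \<open>The CNOT matrix has its ones where the row is the image of the column; as the
      step is an involution, this locates the column as the image of the row.\<close>
    have "(gate_mat n g * U) $$ (r, c) = (\<Sum>k = 0..<2 ^ n. if k = cnot_step g r then U $$ (k, c) else 0)"
      unfolding * using rc cnot_step_twice[OF wf]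
      by (intro sum.cong) (auto simp: gate_mat_def CNOT step[unfolded CNOT])
    moreover have "cnot_step g r < 2 ^ n" using cnot_map_less[OF wf rc(1)] by simp
    ultimately show ?thesis by (simp add: CNOT)
  qed
qed

text \<open>The Hadamard matrix is symmetric, so from the right it acts on rows in the same way as
  from the left on columns.\<close>

lemma mult_had_entry:
  assumes j: "j < n" and U: "U \<in> carrier_mat (2 ^ n) (2 ^ n)" and rc: "r < 2 ^ n" "c < 2 ^ n"
  shows "(U * gate_mat n (Had j)) $$ (r, c) = act (Had j) (\<lambda>k. U $$ (r, k)) c"
proof -
  have G: "gate_mat n (Had j) \<in> carrier_mat (2 ^ n) (2 ^ n)" by simp
  have *: "(U * gate_mat n (Had j)) $$ (r, c) = (\<Sum>k = 0..<2 ^ n. U $$ (r, k) * gate_mat n (Had j) $$ (k, c))"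
    using carrier_matD[OF G] carrier_matD[OF U] rc by (simp add: scalar_prod_def)
  have less: "c XOR 2 ^ j < 2 ^ n" using j rc by (simp add: xor_less_power)
  have "(U * gate_mat n (Had j)) $$ (r, c) = U $$ (r, c) * gate_mat n (Had j) $$ (c, c)
       + U $$ (r, c XOR 2 ^ j) * gate_mat n (Had j) $$ (c XOR 2 ^ j, c)"
    unfolding * using rc less xor_power_neq[of c j]
    by (intro sum_two_points) (auto simp: gate_mat_def flip_bit_eq_xor)
  then show ?thesis using rc less
    by (simp add: gate_mat_def flip_bit_eq_xor qbit_eq_bit sign_def bit_xor_iff add_divide_distrib)
qed

lemma circuit_mat_entry:
  assumes "circuit_wf n gs" "r < 2 ^ n" "c < 2 ^ n"
  shows "circuit_mat n gs $$ (r, c) = fold act gs (\<lambda>k. if k = c then 1 else 0) r"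
  using assms
proof (induction gs arbitrary: r rule: rev_induct)
  case (snoc g gs)
  have g: "gate_wf n g" using snoc.prems by (simp add: circuit_wf_def)
  have gs: "circuit_wf n gs" using snoc.prems by (simp add: circuit_wf_def)
  show ?case
    using act_cong[OF g snoc.IH[OF gs] snoc.prems(2)] snoc.prems
    by (simp add: gate_mat_mult_entry[OF g circuit_mat_carrier])
qed simp

lemma circuit_wf_round: "round_wf n t gs \<Longrightarrow> circuit_wf n gs"
  by (auto simp: round_wf_def circuit_wf_def)

lemma circuit_wf_append [simp]: "circuit_wf n (gs @ hs) \<longleftrightarrow> circuit_wf n gs \<and> circuit_wf n hs"
  by (auto simp: circuit_wf_def)

lemma circuit_mat_eqI:
  assumes "circuit_wf n gs" "circuit_wf n hs" "\<And>f. fold act gs f = fold act hs f"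
  shows "circuit_mat n gs = circuit_mat n hs"
  using assms carrier_matD[OF circuit_mat_carrier[of n gs]] carrier_matD[OF circuit_mat_carrier[of n hs]]
  by (intro eq_matI) (simp_all add: circuit_mat_entry)

section \<open>Inverse circuits\<close>

lemma act_had_twice: "act (Had i) (act (Had i) f) = f"
proof
  fix x
  have s2: "complex_of_real (sqrt 2) * complex_of_real (sqrt 2) = 2"
    by (simp flip: of_real_mult)
  have "act (Had i) (act (Had i) f) x = 2 * f x / (complex_of_real (sqrt 2) * complex_of_real (sqrt 2))"
    by (cases "bit x i") (simp_all add: bit_xor_iff diff_divide_distrib add_divide_distrib)
  then show "act (Had i) (act (Had i) f) x = f x" unfolding s2 by simp
qed

text \<open>Hadamard and CNOT gates are involutions and the phase gate has order 4, so
  \<open>[g, g, g]\<close> inverts any gate \<open>g\<close>.\<close>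

lemma act_power4: "gate_wf n g \<Longrightarrow> act g (act g (act g (act g f))) = f"
proof (cases g)
  case (CNOT a b)
  assume "gate_wf n g"
  then have "round_wf n RC [g]" using CNOT by simp
  from cnot_step_twice[OF this] have "act g (act g f') = f'" for f'
    unfolding CNOT by (intro ext) (simp del: cnot_step.simps)
  then show ?thesis by simp
qed (auto simp: act_had_twice fun_eq_iff simp del: act.simps(1))

lemma circuit_inverse:
  assumes "circuit_wf n gs"
  shows "\<exists>hs. circuit_wf n hs \<and> circuit_mat n (hs @ gs) = 1\<^sub>m (2 ^ n)"
  using assms
proof (induction gs)
  case Nil
  show ?case by (rule exI[of _ "[]"]) (simp add: circuit_wf_def)
next
  case (Cons g gs)
  then have g: "gate_wf n g" and gs: "circuit_wf n gs" by (auto simp: circuit_wf_def)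
  then obtain hs where hs: "circuit_wf n hs" "circuit_mat n (hs @ gs) = 1\<^sub>m (2 ^ n)"
    using Cons.IH by blast
  have "circuit_mat n ((hs @ [g, g, g]) @ g # gs) = circuit_mat n (hs @ gs)"
    using hs(1) g gs by (intro circuit_mat_eqI) (auto simp: circuit_wf_def act_power4[OF g])
  then show ?case
    using hs g by (intro exI[of _ "hs @ [g, g, g]"]) (auto simp: circuit_wf_def)
qed

section \<open>Matrices with quadratic entries, and the induction step for one gate\<close>

text \<open>The \<open>2 n\<close> bits of the pair (row, column) are packed into a single number, so that a gate
  acting from the right is again a gate, acting on the upper \<open>n\<close> bits.\<close>

definition has_quadratic_entries :: "nat \<Rightarrow> complex mat \<Rightarrow> bool" where
  "has_quadratic_entries n U \<longleftrightarrow> (\<exists>k q. cmod k = (1 / sqrt 2) ^ n \<and> quadratic q \<and>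
     (\<forall>r<2 ^ n. \<forall>c<2 ^ n. U $$ (r, c) = k * q (r XOR push_bit n c)))"

lemma act_row:
  assumes "gate_wf n g"
  shows "act g (\<lambda>k. F (k XOR push_bit n c)) r = act g F (r XOR push_bit n c)"
  using assms by (cases g) (auto simp: bit_simps ac_simps)

lemma act_column:
  assumes "r < 2 ^ n"
  shows "act (Had j) (\<lambda>k. F (r XOR push_bit n k)) c = act (Had (n + j)) F (r XOR push_bit n c)"
  using bit_above_nat[OF assms, of "n + j"]
  by (simp add: bit_simps push_bit_xor xor.assoc) (simp add: push_bit_eq_mult power_add mult.commute)

lemma has_quadratic_entriesI:
  assumes "cmod k = (1 / sqrt 2) ^ n" "cmod l = 1" "quadratic q" "\<And>x. G x = l * q x"
    "\<And>r c. r < 2 ^ n \<Longrightarrow> c < 2 ^ n \<Longrightarrow> U $$ (r, c) = k * G (r XOR push_bit n c)"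
  shows "has_quadratic_entries n U"
  unfolding has_quadratic_entries_def
  using assms by (intro exI[of _ "k * l"] exI[of _ q]) (simp add: norm_mult)

text \<open>If \<open>r\<close> were coupled to no column bit, row \<open>r\<close> of
  \<open>U\<close> would be \<open>q r\<close> times row 0, which is impossible for an invertible
  matrix.\<close>

lemma mixed_form_nondegenerate:
  assumes U: "U \<in> carrier_mat (2 ^ n) (2 ^ n)" and V: "V \<in> carrier_mat (2 ^ n) (2 ^ n)"
    and UV: "U * V = 1\<^sub>m (2 ^ n)" and q: "quadratic_with q \<phi>"
    and entries: "\<And>r c. r < 2 ^ n \<Longrightarrow> c < 2 ^ n \<Longrightarrow> U $$ (r, c) = k * q (r XOR push_bit n c)"
    and r: "r < 2 ^ n" "r \<noteq> 0"
  shows "\<exists>j<n. \<phi> r (2 ^ (n + j))"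
proof (rule ccontr)
  assume contra: "\<not> (\<exists>j<n. \<phi> r (2 ^ (n + j)))"
  have zero: "\<not> \<phi> r (push_bit n c)" if "c < 2 ^ n" for c
    using functional_eqI[of "\<lambda>c. \<phi> r (push_bit n c)" "\<lambda>_. False" n c] contra that
      functional_compose[OF quadratic_withD(1)[OF q] linear_xor_push_bit]
    by (auto simp: functional_def push_bit_eq_mult power_add mult.commute)
  have row: "U $$ (r, c) = q r * U $$ (0, c)" if "c < 2 ^ n" for c
    using zero[OF that] that r(1) by (simp add: entries quadratic_withD(5)[OF q])
  have sum: "(U * V) $$ (i, j) = (\<Sum>l = 0..<2 ^ n. U $$ (i, l) * V $$ (l, j))"
    if "i < 2 ^ n" "j < 2 ^ n" for i j
    using carrier_matD[OF U] carrier_matD[OF V] that by (simp add: scalar_prod_def)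
  have "1 = (U * V) $$ (r, r)" using r by (simp add: UV)
  also have "\<dots> = q r * (U * V) $$ (0, r)"
    using r by (simp add: sum row sum_distrib_left mult.assoc)
  also have "\<dots> = 0" using r by (simp add: UV)
  finally show False by simp
qed

lemma has_quadratic_entries_step:
  assumes U: "U \<in> carrier_mat (2 ^ n) (2 ^ n)" and V: "V \<in> carrier_mat (2 ^ n) (2 ^ n)"
    and UV: "U * V = 1\<^sub>m (2 ^ n)" and quad: "has_quadratic_entries n U" and g: "gate_wf n g"
  shows "has_quadratic_entries n (gate_mat n g * U) \<or>
    (\<exists>j<n. has_quadratic_entries n (gate_mat n g * U * gate_mat n (Had j)))"
proof -
  obtain k q where k: "cmod k = (1 / sqrt 2) ^ n" and q: "quadratic q"
    and entries: "\<And>r c. r < 2 ^ n \<Longrightarrow> c < 2 ^ n \<Longrightarrow> U $$ (r, c) = k * q (r XOR push_bit n c)"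
    using quad by (auto simp: has_quadratic_entries_def)
  from q obtain \<phi> where \<phi>: "quadratic_with q \<phi>" by (auto simp: quadratic_def)
  have gU: "(gate_mat n g * U) $$ (r, c) = k * act g q (r XOR push_bit n c)"
    if rc: "r < 2 ^ n" "c < 2 ^ n" for r c
  proof -
    have "(gate_mat n g * U) $$ (r, c) = act g (\<lambda>l. U $$ (l, c)) r"
      using gate_mat_mult_entry[OF g U rc] .
    also have "\<dots> = act g (\<lambda>l. k * q (l XOR push_bit n c)) r"
      using rc by (intro act_cong[OF g]) (simp_all add: entries)
    finally show ?thesis by (simp only: act_scale act_row[OF g])
  qed
  show ?thesis
  proof (cases g)
    case (Phase i)
    then have "quadratic (act g q)" using act_phase_quadratic[OF q] by simp
    then show ?thesis
      using has_quadratic_entriesI[OF k, of 1 "act g q" "act g q"] gU by simp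
  next
    case (CNOT a b)
    then have "quadratic (act g q)" using act_cnot_quadratic[OF q] by simp
    then show ?thesis
      using has_quadratic_entriesI[OF k, of 1 "act g q" "act g q"] gU by simp
  next
    case (Had i)
    show ?thesis
    proof (cases "\<phi> (2 ^ i) (2 ^ i)")
      case True
      then show ?thesis
        using act_had_odd[OF \<phi> True] has_quadratic_entriesI[OF k _ _ _ gU] Had by blast
    next
      case False
      \<comment> \<open>Nondegeneracy at the basis vector \<open>2 ^ i\<close> provides the column
        bit that rescues the vanishing sum.\<close>
      obtain j where j: "j < n" "\<phi> (2 ^ i) (2 ^ (n + j))"
        using mixed_form_nondegenerate[OF U V UV \<phi> entries, of "2 ^ i"] g Had by auto
      have gUh: "(gate_mat n g * U * gate_mat n (Had j)) $$ (r, c)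
          = k * act (Had (n + j)) (act (Had i) q) (r XOR push_bit n c)"
        if rc: "r < 2 ^ n" "c < 2 ^ n" for r c
      proof -
        have "(gate_mat n g * U * gate_mat n (Had j)) $$ (r, c)
            = act (Had j) (\<lambda>l. (gate_mat n g * U) $$ (r, l)) c"
          using mult_had_entry[OF j(1) mult_carrier_mat[OF gate_mat_carrier U] rc] .
        also have "\<dots> = act (Had j) (\<lambda>l. k * act g q (r XOR push_bit n l)) c"
          using rc j(1) by (intro act_cong[of n]) (simp_all add: gU)
        finally show ?thesis by (simp only: act_scale act_column[OF rc(1)] Had)
      qed
      show ?thesis
        using act_had_had_even[OF \<phi> False j(2)] has_quadratic_entriesI[OF k _ _ _ gUh] j(1) by blast
    qed
  qed
qed

section \<open>The Walsh-Hadamard kernel and the base case\<close>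

fun dot_parity :: "nat \<Rightarrow> nat \<Rightarrow> nat \<Rightarrow> bool" where
  "dot_parity 0 x y = False"
| "dot_parity (Suc k) x y = (dot_parity k x y \<noteq> (bit x k \<and> bit y k))"

lemma dot_parity_flip: "k \<le> i \<Longrightarrow> dot_parity k (x XOR 2 ^ i) y = dot_parity k x y"
  by (induction k) (auto simp: bit_xor_iff)

lemma functional_dot_parity: "functional (dot_parity k x)"
  by (induction k) (auto simp: functional_def bit_xor_iff)

lemma dot_parity_power: "j < k \<Longrightarrow> dot_parity k x (2 ^ j) = bit x j"
proof -
  have "dot_parity k x (2 ^ j) = (j < k \<and> bit x j)" by (induction k) (auto simp: less_Suc_eq)
  then show "j < k \<Longrightarrow> ?thesis" by simp
qed

lemma drop_bit_eq_iff_bits: "drop_bit k x = drop_bit k y \<longleftrightarrow> (\<forall>i\<ge>k. bit x i = bit y i)" for x y :: nat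
  by (auto simp: bit_eq_iff bit_drop_bit_eq) (metis le_iff_add)+

lemma drop_bit_eq_Suc:
  "drop_bit k x = drop_bit k y \<longleftrightarrow> bit x k = bit y k \<and> drop_bit (Suc k) x = drop_bit (Suc k) y"
  for x y :: nat
  unfolding drop_bit_eq_iff_bits by (metis Suc_leD Suc_leI le_eq_less_or_eq)

lemma drop_bit_Suc_flip: "drop_bit (Suc k) (x XOR 2 ^ k) = drop_bit (Suc k) x" for x :: nat
  by (simp add: drop_bit_eq_iff_bits bit_xor_iff del: drop_bit_xor)

text \<open>After Hadamard gates on the lowest \<open>k\<close> qubits, those bits carry the kernel
  of the transform, while the remaining bits of row and column must still agree. The weight
  \<open>f c\<close> lets a diagonal precede the layer.\<close>

lemma fold_act_hadamards:
  "fold act (map Had [0..<k]) (\<lambda>x. f x * (if x = c then 1 else 0)) r =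
    f c * (1 / complex_of_real (sqrt 2)) ^ k *
      (if drop_bit k r = drop_bit k c then sign (dot_parity k r c) else 0)"
proof (induction k arbitrary: r)
  case (Suc k)
  have "bit (r XOR 2 ^ k) k = (\<not> bit r k)" by (simp add: bit_xor_iff)
  then show ?case
    by (cases "bit r k"; cases "bit c k")
      (simp_all add: Suc.IH drop_bit_eq_Suc[of k] drop_bit_Suc_flip dot_parity_flip sign_def
        del: drop_bit_xor)
qed simp

lemma round_wf_all_hadamards: "round_wf n RH (map Had [0..<n])"
  by (auto simp: round_wf_def)

lemma round_wf_all_phases: "round_wf n RP (map Phase [0..<n])"
  by (auto simp: round_wf_def)

lemma quadratic_const_1: "quadratic (\<lambda>_. 1)"
  using quadratic_root[of "\<lambda>_. False" 1] by (simp add: functional_def)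

text \<open>In a packed pair the low bits are the row and \<open>drop_bit n\<close> recovers the
  column, so each summand is a product of two functionals.\<close>

lemma quadratic_dot_parity: "quadratic (\<lambda>z. sign (dot_parity k z (drop_bit n z)))"
proof (induction k)
  case (Suc k)
  have "linear_xor (drop_bit n)" by (simp add: linear_xor_def)
  then have "quadratic (\<lambda>z. sign (bit z k \<and> bit (drop_bit n z) k))"
    by (intro quadratic_sign_conj functional_bit functional_compose[OF functional_bit])
  from quadratic_mult[OF Suc this] show ?case
    by (rule back_subst[of quadratic]) (auto simp: fun_eq_iff sign_def)
qed (simp add: quadratic_const_1)

lemma dot_parity_xor_push_bit: "k \<le> n \<Longrightarrow> dot_parity k (x XOR push_bit n y) z = dot_parity k x z"
  by (induction k) (auto simp: bit_simps)

lemma hadamards_has_quadratic_entries: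
  "has_quadratic_entries n (circuit_mat n (map Had [0..<n]))"
proof (rule has_quadratic_entriesI)
  show "cmod ((1 / complex_of_real (sqrt 2)) ^ n) = (1 / sqrt 2) ^ n"
    by (simp add: norm_power norm_divide)
  show "quadratic (\<lambda>z. sign (dot_parity n z (drop_bit n z)))" by (rule quadratic_dot_parity)
  show "cmod 1 = 1" by simp
  show "sign (dot_parity n x (drop_bit n x)) = 1 * sign (dot_parity n x (drop_bit n x))" for x by simp
  fix r c :: nat
  assume rc: "r < 2 ^ n" "c < 2 ^ n"
  then have "drop_bit n r = 0" "drop_bit n c = 0" by (simp_all add: drop_bit_eq_div)
  then have "drop_bit n (r XOR push_bit n c) = c"
    using bit_above_nat[OF rc(1)] by (intro bit_eqI) (simp add: bit_simps del: drop_bit_xor)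
  then show "circuit_mat n (map Had [0..<n]) $$ (r, c) = (1 / complex_of_real (sqrt 2)) ^ n *
      sign (dot_parity n (r XOR push_bit n c) (drop_bit n (r XOR push_bit n c)))"
    using fold_act_hadamards[of n "\<lambda>_. 1" c r] \<open>drop_bit n r = 0\<close> \<open>drop_bit n c = 0\<close> rc
    by (simp add: circuit_mat_entry[OF circuit_wf_round[OF round_wf_all_hadamards]] dot_parity_xor_push_bit)
qed

text \<open>The induction on the circuit. A qubit may occur several times in the layer
  \<open>hs\<close>, so \<open>Had j\<close> can always be put in front; the empty circuit starts
  with Hadamard gates on all qubits.\<close>

lemma hadamards_before_circuit:
  assumes "circuit_wf n gs"
  shows "\<exists>hs. round_wf n RH hs \<and> has_quadratic_entries n (circuit_mat n (hs @ gs))"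
  using assms
proof (induction gs rule: rev_induct)
  case Nil
  show ?case using hadamards_has_quadratic_entries round_wf_all_hadamards by auto
next
  case (snoc g gs)
  then have g: "gate_wf n g" and gs: "circuit_wf n gs" by (auto simp: circuit_wf_def)
  then obtain hs where hs: "round_wf n RH hs" "has_quadratic_entries n (circuit_mat n (hs @ gs))"
    using snoc.IH by blast
  have "circuit_wf n (hs @ gs)" using circuit_wf_round[OF hs(1)] gs by simp
  from circuit_inverse[OF this] obtain vs
    where vs: "circuit_mat n (hs @ gs) * circuit_mat n vs = 1\<^sub>m (2 ^ n)"
    by (auto simp: circuit_mat_append[of n vs "hs @ gs" for vs])
  consider "has_quadratic_entries n (gate_mat n g * circuit_mat n (hs @ gs))"
    | j where "j < n"
      "has_quadratic_entries n (gate_mat n g * circuit_mat n (hs @ gs) * gate_mat n (Had j))"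
    using has_quadratic_entries_step[OF circuit_mat_carrier circuit_mat_carrier vs hs(2) g] by blast
  then show ?case
  proof cases
    case 1
    then show ?thesis using hs(1) circuit_mat_snoc[of n "hs @ gs" g] by auto
  next
    case 2
    have single: "circuit_mat n [h] = gate_mat n h" for h
      using circuit_mat_snoc[of n "[]" h] right_mult_one_mat[OF gate_mat_carrier] by simp
    have "circuit_mat n ((Had j # hs) @ gs @ [g])
        = gate_mat n g * circuit_mat n (hs @ gs) * gate_mat n (Had j)"
      using circuit_mat_append[of n "[Had j]" "hs @ gs @ [g]"] circuit_mat_snoc[of n "hs @ gs" g]
      by (simp add: single)
    then show ?thesis using 2 hs(1) by (intro exI[of _ "Had j # hs"]) simp
  qed
qed

section \<open>From quadratic entries to a circuit\<close>

lemma diagonal_as_circuit: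
  assumes "quadratic q"
  shows "\<exists>gs ps. round_wf n RC gs \<and> round_wf n RP ps \<and>
    (\<forall>f. \<forall>x<2 ^ n. fold act (rev gs @ map Phase [0..<n] @ gs @ ps) f x = q x * f x \<and>
      fold act (ps @ rev gs @ map Phase [0..<n] @ gs) f x = q x * f x)"
proof -
  obtain gs ps where gs: "round_wf n RC gs" and ps: "round_wf n RP ps"
    and q: "\<And>x. x < 2 ^ n \<Longrightarrow>
      q x = phase_factor (map Phase [0..<n]) (cnot_map gs x) * phase_factor ps x"
    using quadratic_decompose[OF assms] by blast
  have "round_wf n RC (rev gs)" using gs by simp
  note fold_simps = fold_act_cnots[OF gs] fold_act_cnots[OF this] fold_act_phases[OF ps]
    fold_act_phases[OF round_wf_all_phases] cnot_map_rev[OF gs]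
  \<comment> \<open>The conjugated phase round and the round \<open>ps\<close> are both diagonal and
    commute. The order ending in \<open>ps\<close> is used before the Hadamard layer, the order
    starting with it afterwards.\<close>
  show ?thesis
    using gs ps by (intro exI[of _ gs] exI[of _ ps]) (simp add: fold_simps q)
qed

lemma less_power_if_bits: "(\<And>i. n \<le> i \<Longrightarrow> \<not> bit x i) \<Longrightarrow> x < 2 ^ n" for x :: nat
  by (metis bit_eqI bit_take_bit_iff not_le take_bit_nat_eq_self_iff)

lemma quadratic_entries_as_circuit:
  assumes U: "U \<in> carrier_mat (2 ^ n) (2 ^ n)" and V: "V \<in> carrier_mat (2 ^ n) (2 ^ n)"
    and UV: "U * V = 1\<^sub>m (2 ^ n)" and quad: "has_quadratic_entries n U"
  shows "\<exists>k rs. cmod k = 1 \<and> U = k \<cdot>\<^sub>m circuit_mat n (concat rs) \<and>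
    list_all2 (round_wf n) (tl canonical_pattern) rs"
proof -
  obtain k q where k: "cmod k = (1 / sqrt 2) ^ n" and q: "quadratic q"
    and entries: "\<And>r c. r < 2 ^ n \<Longrightarrow> c < 2 ^ n \<Longrightarrow> U $$ (r, c) = k * q (r XOR push_bit n c)"
    using quad by (auto simp: has_quadratic_entries_def)
  from q obtain \<phi> where \<phi>: "quadratic_with q \<phi>" by (auto simp: quadratic_def)
  \<comment> \<open>The mixed block of the polar form as a linear map: \<open>horner_sum\<close>
    packs the couplings of \<open>r\<close> to the \<open>n\<close> column bits into one number, so
    that the inner product of \<open>L r\<close> with \<open>c\<close> is
    \<open>\<phi> r (push_bit n c)\<close>.\<close>
  define L where "L = (\<lambda>r. horner_sum of_bool (2::nat) (map (\<lambda>j. \<phi> r (2 ^ (n + j))) [0..<n]))"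
  have bit_L: "bit (L r) j = (j < n \<and> \<phi> r (2 ^ (n + j)))" for r j
    by (auto simp: L_def bit_horner_sum_bit_iff)
  have L_less: "L r < 2 ^ n" for r
    by (rule less_power_if_bits) (simp add: bit_L)
  have L: "linear_xor L"
    unfolding linear_xor_def
    by (auto intro!: bit_eqI simp: bit_xor_iff bit_L functional_xor[OF quadratic_withD(2)[OF \<phi>]])
  have L0: "r = 0" if "r < 2 ^ n" "L r = 0" for r
    using mixed_form_nondegenerate[OF U V UV \<phi> entries that(1)] that(2) bit_L by (metis bit_0_eq bot_apply bot_bool_def)
  have dot: "dot_parity n (L r) c = \<phi> r (push_bit n c)" if "c < 2 ^ n" for r c
    by (rule functional_eqI[OF functional_dot_parity
          functional_compose[OF quadratic_withD(1)[OF \<phi>] linear_xor_push_bit] _ that])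
      (simp add: dot_parity_power bit_L push_bit_eq_mult power_add mult.commute)
  obtain g where g: "round_wf n RC g" "\<And>x. x < 2 ^ n \<Longrightarrow> cnot_map g x = L x"
    using linear_as_cnots[OF L L_less L0] by blast
  obtain gs ps where v: "round_wf n RC gs" "round_wf n RP ps"
    "\<And>f x. x < 2 ^ n \<Longrightarrow> fold act (rev gs @ map Phase [0..<n] @ gs @ ps) f x = q (push_bit n x) * f x"
    using diagonal_as_circuit[OF quadratic_compose[OF q linear_xor_push_bit]] by blast
  \<comment> \<open>This diagonal acts before the circuit \<open>g\<close>, hence at index
    \<open>L r\<close>; \<open>rev g\<close> takes the index back to \<open>r\<close>.\<close>
  obtain gs' ps' where u: "round_wf n RC gs'" "round_wf n RP ps'"
    "\<And>f x. x < 2 ^ n \<Longrightarrow>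
      fold act (ps' @ rev gs' @ map Phase [0..<n] @ gs') f x = q (cnot_map (rev g) x) * f x"
    using diagonal_as_circuit[OF quadratic_compose[OF q linear_cnot_map]] by blast
  \<comment> \<open>The empty list fills the C round in front of the Hadamard layer, and the last C
    round joins \<open>gs'\<close> with the circuit \<open>g\<close> for \<open>L\<close>.\<close>
  define rs where "rs = [rev gs, map Phase [0..<n], gs, ps, [], map Had [0..<n],
    ps', rev gs', map Phase [0..<n], gs' @ g]"
  let ?had = "map Had [0..<n]" and ?s = "(1 / complex_of_real (sqrt 2)) ^ n"
  have concat: "concat rs = (rev gs @ map Phase [0..<n] @ gs @ ps) @ ?had @
      (ps' @ rev gs' @ map Phase [0..<n] @ gs') @ g"
    by (simp add: rs_def)
  have wf: "circuit_wf n (concat rs)"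
    unfolding concat using g(1) u(1,2) v(1,2)
    by (simp add: circuit_wf_round circuit_wf_round[OF round_wf_all_hadamards]
        circuit_wf_round[OF round_wf_all_phases])
  have entry: "circuit_mat n (concat rs) $$ (r, c) = ?s * q (r XOR push_bit n c)"
    if rc: "r < 2 ^ n" "c < 2 ^ n" for r c
  proof -
    define F where "F = fold act ?had (fold act (rev gs @ map Phase [0..<n] @ gs @ ps) (\<lambda>x. if x = c then 1 else 0))"
    have "circuit_mat n (concat rs) $$ (r, c)
        = fold act g (fold act (ps' @ rev gs' @ map Phase [0..<n] @ gs') F) r"
      unfolding circuit_mat_entry[OF wf rc] F_def by (simp add: concat)
    also have "\<dots> = q (cnot_map (rev g) (L r)) * F (L r)"
      unfolding fold_act_cnots[OF g(1)] g(2)[OF rc(1)] by (rule u(3)[OF L_less])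
    also have "cnot_map (rev g) (L r) = r"
      using cnot_map_rev[OF g(1), of r] g(2)[OF rc(1)] by simp
    also have "F (L r) = fold act ?had (\<lambda>x. q (push_bit n x) * (if x = c then 1 else 0)) (L r)"
      unfolding F_def
      by (rule fold_act_cong[OF circuit_wf_round[OF round_wf_all_hadamards] v(3) L_less])
    also have "\<dots> = q (push_bit n c) * ?s * sign (dot_parity n (L r) c)"
      using fold_act_hadamards[of n "\<lambda>x. q (push_bit n x)" c "L r"] L_less[of r] rc(2)
      by (simp add: drop_bit_eq_div)
    \<comment> \<open>The row part, the column part and the mixed sign recombine to \<open>q\<close>
      at the packed index.\<close>
    finally show ?thesis by (simp add: dot[OF rc(2)] quadratic_withD(5)[OF \<phi>])
  qed
  have s: "?s * complex_of_real (sqrt 2) ^ n = 1"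
    by (simp flip: power_mult_distrib)
  \<comment> \<open>The constant \<open>k\<close> has modulus \<open>(1 / sqrt 2) ^ n\<close>, as
    does the normalization of the Hadamard layer, so their quotient is a global phase.\<close>
  have "U = (k * complex_of_real (sqrt 2) ^ n) \<cdot>\<^sub>m circuit_mat n (concat rs)"
  proof (rule eq_matI)
    fix r c
    assume "r < dim_row ((k * complex_of_real (sqrt 2) ^ n) \<cdot>\<^sub>m circuit_mat n (concat rs))"
      "c < dim_col ((k * complex_of_real (sqrt 2) ^ n) \<cdot>\<^sub>m circuit_mat n (concat rs))"
    then have rc: "r < 2 ^ n" "c < 2 ^ n"
      using carrier_matD[OF circuit_mat_carrier[of n "concat rs"]] by simp_all
    have "(k * complex_of_real (sqrt 2) ^ n) * (?s * q (r XOR push_bit n c))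
        = k * q (r XOR push_bit n c) * (?s * complex_of_real (sqrt 2) ^ n)"
      by (simp only: ac_simps)
    then show "U $$ (r, c) = ((k * complex_of_real (sqrt 2) ^ n) \<cdot>\<^sub>m circuit_mat n (concat rs)) $$ (r, c)"
      using rc carrier_matD[OF circuit_mat_carrier[of n "concat rs"]]
      unfolding s by (simp add: entries entry)
  qed (use U carrier_matD[OF circuit_mat_carrier[of n "concat rs"]] in auto)
  moreover have "cmod (k * complex_of_real (sqrt 2) ^ n) = 1"
    by (simp add: norm_mult norm_power k flip: power_mult_distrib)
  moreover have "list_all2 (round_wf n) (tl canonical_pattern) rs"
    using g(1) u(1,2) v(1,2) round_wf_all_hadamards round_wf_all_phases
    by (simp add: rs_def canonical_pattern_def)
  ultimately show ?thesis by blast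
qed

section \<open>Assembly of the eleven rounds\<close>

lemma canonical_form_concat:
  assumes "list_all2 (round_wf n) canonical_pattern rs"
  shows "circuit_wf n (concat rs)" "canonical_form (concat rs)"
proof -
  have *: "length rs = length canonical_pattern"
    "\<And>k. k < length rs \<Longrightarrow> round_wf n (canonical_pattern ! k) (rs ! k)"
    using assms by (auto simp: list_all2_conv_all_nth)
  show "canonical_form (concat rs)"
    unfolding canonical_form_def using * by (intro exI[of _ rs]) (auto simp: round_wf_def)
  show "circuit_wf n (concat rs)"
    using *(2) by (fastforce simp: circuit_wf_def round_wf_def in_set_conv_nth[of _ rs])
qed

text \<open>Equal gates meet in the middle and cancel in pairs from the inside outwards.\<close>

lemma fold_act_hadamards_rev:
  "round_wf n RH hs \<Longrightarrow> fold act hs (fold act (rev hs) f) = f"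
proof (induction hs arbitrary: f)
  case (Cons h hs)
  then obtain i where "h = Had i" using gate_of_type_cases(1)[of h] by auto
  with Cons show ?case by (simp add: act_had_twice del: act.simps)
qed simp

theorem theorem8:
  fixes n :: nat and C :: "gate list"
  assumes "circuit_wf n C"
  shows "\<exists>C'. circuit_wf n C' \<and> canonical_form C' \<and> circuit_equiv n C C'"
proof -
  obtain hs where hs: "round_wf n RH hs" "has_quadratic_entries n (circuit_mat n (hs @ C))"
    using hadamards_before_circuit[OF assms] by blast
  have wf: "circuit_wf n (hs @ C)" "circuit_wf n (rev hs @ hs @ C)"
    using circuit_wf_round[of n RH hs] circuit_wf_round[of n RH "rev hs"] hs(1) assms by simp_all
  obtain vs where "circuit_mat n (vs @ hs @ C) = 1\<^sub>m (2 ^ n)"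
    using circuit_inverse[OF wf(1)] by blast
  then have "circuit_mat n (hs @ C) * circuit_mat n vs = 1\<^sub>m (2 ^ n)"
    by (simp add: circuit_mat_append[of n vs "hs @ C"])
  then obtain k rs where k: "cmod k = 1"
    and rs: "circuit_mat n (hs @ C) = k \<cdot>\<^sub>m circuit_mat n (concat rs)"
      "list_all2 (round_wf n) (tl canonical_pattern) rs"
    using quadratic_entries_as_circuit[OF circuit_mat_carrier circuit_mat_carrier _ hs(2)] by blast
  have all: "list_all2 (round_wf n) canonical_pattern (rev hs # rs)"
    using rs(2) hs(1) by (simp add: canonical_pattern_def)
  \<comment> \<open>Inserting the cancelling pair splits the circuit: \<open>rev hs\<close> becomes
    the first H round, and \<open>hs @ C\<close> is replaced by the other ten rounds.\<close>
  have "circuit_mat n C = circuit_mat n (rev hs @ hs @ C)"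
    using assms wf(2) by (intro circuit_mat_eqI) (simp_all add: fold_act_hadamards_rev[OF hs(1)])
  also have "\<dots> = (k \<cdot>\<^sub>m circuit_mat n (concat rs)) * circuit_mat n (rev hs)"
    unfolding circuit_mat_append[of n "rev hs"] rs(1) ..
  also have "\<dots> = k \<cdot>\<^sub>m circuit_mat n (concat (rev hs # rs))"
    using mult_smult_assoc_mat[OF circuit_mat_carrier circuit_mat_carrier]
    by (simp add: circuit_mat_append[of n "rev hs"])
  finally have "circuit_equiv n C (concat (rev hs # rs))"
    unfolding circuit_equiv_def using k by blast
  then show ?thesis using canonical_form_concat[OF all] by blast
qed

end
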